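(* Let $X$ be a random variable with distribution function $F$ such that $\overline F=1-F\in\mathcal{RV}_{-\alpha}(b)$, $\alpha>0$. Assume there exist a function $A$ with $A(t)\to0$ as $t\to\infty$ that is ultimately of constant sign, with $|A|\in\mathcal{RV}_\rho$, $\rho\le0$, and constants $c\ne0$, $c^*\in\mathbb R$ with $c\neq c^*\rho$, such that $$\lim_{t\to\infty}\frac{t\overline F(b(t)x)-x^{-\alpha}}{A(b(t))}=c\,x^{-\alpha}\frac{x^\rho-1}{\rho}+c^*x^{-\alpha},\qquad x>0,$$ where for $\rho=0$ the right-hand side is $c\,x^{-\alpha}\log x+c^*x^{-\alpha}$. Then there exist functions $\tilde b\in\mathcal{RV}_{1/\alpha}$ and $\tilde A$ with $\tilde A(t)\to0$ as $t\to\infty$, $\tilde A$ ultimately of constant sign and $|\tilde A|\in\mathcal{RV}_\rho$, such that $$X\in2\mathcal{RV}_{-\alpha,\rho}(\tilde b,\tilde A,\tilde H)\quad\text{where}\quad\tilde H(x)=c\,x^{-\alpha}\frac{x^\rho-1}{\rho},\qquad x>0.$$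
   Context: $\mathcal{RV}_\rho$ ($\rho\in\mathbb R$) is the class of functions $f:\mathbb R_+\to\mathbb R_+$ with $\lim_{t\to\infty}f(tx)/f(t)=x^\rho$ for all $x>0$. $\overline F\in\mathcal{RV}_{-\alpha}(b)$, $\alpha>0$, means $b:\mathbb R_+\to\mathbb R_+$, $b(t)\uparrow\infty$ as $t\to\infty$ and $\lim_{t\to\infty}t\overline F(b(t)x)=x^{-\alpha}$ for $x>0$. $X\in2\mathcal{RV}_{-\alpha,\rho}(b,A,H)$ with $\alpha>0$, $\rho\le0$ means that $\overline F\in\mathcal{RV}_{-\alpha}(b)$, $A(t)\to0$ as $t\to\infty$, $A$ is ultimately of constant sign, $|A|\in\mathcal{RV}_\rho$, and for some $c\neq0$ $$\lim_{t\to\infty}\frac{t\overline F(b(t)x)-x^{-\alpha}}{A(b(t))}=H(x)=c\,x^{-\alpha}\frac{x^\rho-1}{\rho},\qquad x>0,$$ with $H(x)=c\,x^{-\alpha}\log x$ when $\rho=0$. *)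

theory Defs
  imports "HOL-Probability.Probability"
begin

text \<open>
  Functions on \<open>\<real>\<^sub>+ = [0, \<infinity>)\<close> are modelled as total functions on the reals whose
  values on negative arguments are irrelevant.
\<close>

definition nonneg_on_nonneg :: "(real \<Rightarrow> real) \<Rightarrow> bool" where
  "nonneg_on_nonneg f \<longleftrightarrow> (\<forall>t\<ge>0. f t \<ge> 0)"

text \<open>
  Since \<open>0 / 0 = 0\<close>, the case \<open>x = 1\<close> of the limit forces \<open>f\<close> to be eventually nonzero.
\<close>

definition RV :: "real \<Rightarrow> (real \<Rightarrow> real) set" where
  "RV \<rho> = {f. nonneg_on_nonneg f \<and>
              (\<forall>x>0. ((\<lambda>t. f (t * x) / f t) \<longlongrightarrow> x powr \<rho>) at_top)}"

definition tail :: "'a measure \<Rightarrow> ('a \<Rightarrow> real) \<Rightarrow> real \<Rightarrow> real" where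
  "tail M X x = 1 - cdf (distr M borel X) x"

text \<open>
  The class \<open>\<R>\<V>\<close> with index \<open>-\<alpha>\<close> and scaling function \<open>b\<close>; the argument \<open>\<alpha>\<close> is the
  negated index. The condition \<open>b(t) \<up> \<infinity>\<close> is read as: nondecreasing with limit \<open>\<infinity>\<close>.
\<close>

definition RV_tail :: "real \<Rightarrow> (real \<Rightarrow> real) \<Rightarrow> (real \<Rightarrow> real) set" where
  "RV_tail \<alpha> b = {Fbar. \<alpha> > 0 \<and> nonneg_on_nonneg b \<and>
     mono_on {0..} b \<and> filterlim b at_top at_top \<and>
     (\<forall>x>0. ((\<lambda>t. t * Fbar (b t * x)) \<longlongrightarrow> x powr (-\<alpha>)) at_top)}"

definition ultimately_constant_sign :: "(real \<Rightarrow> real) \<Rightarrow> bool" where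
  "ultimately_constant_sign A \<longleftrightarrow> (\<exists>s. \<forall>\<^sub>F t in at_top. sgn (A t) = s)"

definition H_2RV :: "real \<Rightarrow> real \<Rightarrow> real \<Rightarrow> real \<Rightarrow> real" where
  "H_2RV \<alpha> \<rho> c x =
     c * x powr (-\<alpha>) * (if \<rho> = 0 then ln x else (x powr \<rho> - 1) / \<rho>)"

text \<open>
  Second-order regular variation of the random variable \<open>X\<close> on \<open>M\<close>, with indices
  \<open>-\<alpha>\<close> and \<open>\<rho>\<close>.
\<close>

definition second_order_RV ::
  "'a measure \<Rightarrow> ('a \<Rightarrow> real) \<Rightarrow> real \<Rightarrow> real \<Rightarrow>
   (real \<Rightarrow> real) \<Rightarrow> (real \<Rightarrow> real) \<Rightarrow> (real \<Rightarrow> real) \<Rightarrow> bool" where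
  "second_order_RV M X \<alpha> \<rho> b A H \<longleftrightarrow>
     \<alpha> > 0 \<and> \<rho> \<le> 0 \<and>
     tail M X \<in> RV_tail \<alpha> b \<and>
     (A \<longlongrightarrow> 0) at_top \<and> ultimately_constant_sign A \<and> (\<lambda>t. \<bar>A t\<bar>) \<in> RV \<rho> \<and>
     (\<exists>c. c \<noteq> 0 \<and> (\<forall>x>0. H x = H_2RV \<alpha> \<rho> c x \<and>
        ((\<lambda>t. (t * tail M X (b t * x) - x powr (-\<alpha>)) / A (b t)) \<longlongrightarrow> H x) at_top))"

end

theory Submission
  imports Defs
begin

text \<open>
  Put \<open>a(t) = A(b(t))\<close>. Reparametrise by a nondecreasing \<open>T\<close> and keep \<open>A\<close>: with
  \<open>b' = b \<circ> T\<close>, the quotient for \<open>b'\<close> at \<open>t\<close> is \<open>t / T(t)\<close> times the quotient for \<open>b\<close> at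
  \<open>T(t)\<close>, plus \<open>x powr (-\<alpha>) * (t / T(t) - 1) / a(T(t))\<close>. So the extra term
  \<open>c' * x powr (-\<alpha>)\<close> is cancelled as soon as \<open>(t / T(t) - 1) / a(T(t)) \<longrightarrow> -c'\<close>. The
  generalised inverse \<open>T\<close> of \<open>V(s) = 1 / F(b(s))\<close>, \<open>F\<close> the tail, does this, because the hypothesis
  at \<open>x = 1\<close> gives \<open>(V(s) / s - 1) / a(s) \<longrightarrow> -c'\<close>, provided that the jumps of \<open>V\<close> are negligible
  relative to \<open>a\<close>. That holds if \<open>a(s') / a(s) \<longrightarrow> 1\<close> whenever \<open>s' / s \<longrightarrow> 1\<close>.

  Since \<open>A\<close> need not be measurable, this last property is drawn from the second-order limit instead
  of from the regular variation of \<open>A\<close>. Let \<open>r = b(s') / b(s)\<close> and let \<open>f(t, z)\<close> be the quotient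
  multiplied by \<open>z powr \<alpha>\<close>; it converges to a nonconstant continuous \<open>k(z)\<close>. As
  \<open>F(b(s') z) = F(b(s) r z)\<close>, the differences \<open>a(s') (f(s', y) - f(s', z))\<close> and
  \<open>a(s) (f(s, r y) - f(s, r z))\<close> agree up to a factor tending to \<open>1\<close>. Pointwise convergence of
  measurable functions is convergence in measure, and \<open>r \<longrightarrow> 1\<close>, so \<open>y\<close> and \<open>z\<close> can be chosen
  (depending on \<open>s, s'\<close>) such that all four values are near the two distinct values of \<open>k\<close>.
\<close>

section \<open>Convergence in measure and evaluation at perturbed points\<close>

text \<open>Each point of the interval eventually leaves the deviation sets, so their indicators
  tend to 0 pointwise. Dominated convergence, with the indicator of \<open>{p..q}\<close> as
  majorant, carries this over to the measures.\<close>

lemma deviation_set_measure_tendsto_0: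
  fixes f :: "nat \<Rightarrow> real \<Rightarrow> real"
  assumes [measurable]: "\<And>n. f n \<in> borel_measurable borel" "k \<in> borel_measurable borel"
    and conv: "\<And>x. x \<in> {p..q} \<Longrightarrow> (\<lambda>n. f n x) \<longlonglongrightarrow> k x"
    and "e > 0"
  shows "(\<lambda>n. measure lborel {x \<in> {p..q}. \<not> \<bar>f n x - k x\<bar> < e}) \<longlonglongrightarrow> 0"
proof -
  define E where "E n = {x \<in> {p..q}. \<not> \<bar>f n x - k x\<bar> < e}" for n
  have [measurable]: "E n \<in> sets borel" for n
  proof -
    have "E n = {p..q} \<inter> {x \<in> space borel. \<not> \<bar>f n x - k x\<bar> < e}"
      by (auto simp: E_def)
    also have "\<dots> \<in> sets borel" by measurable
    finally show ?thesis .
  qed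
  have "(\<lambda>n. \<integral>x. indicator (E n) x \<partial>lborel) \<longlonglongrightarrow> (\<integral>x. (0::real) \<partial>(lborel :: real measure))"
  proof (rule integral_dominated_convergence[where w = "indicat_real {p..q}"])
    show "integrable lborel (indicator {p..q} :: real \<Rightarrow> real)"
      by (simp add: integrable_indicator_iff emeasure_lborel_Icc_eq)
    show "AE x in lborel. (\<lambda>n. indicator (E n) x :: real) \<longlonglongrightarrow> 0"
    proof (rule AE_I2)
      fix x :: real
      have "\<forall>\<^sub>F n in sequentially. x \<notin> E n"
      proof (cases "x \<in> {p..q}")
        case True
        have "\<forall>\<^sub>F n in sequentially. dist (f n x) (k x) < e"
          using conv[OF True] \<open>e > 0\<close> by (rule tendstoD)
        then show ?thesis
          by eventually_elim (auto simp: E_def dist_real_def)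
      qed (auto simp: E_def)
      then have "\<forall>\<^sub>F n in sequentially. (indicator (E n) x :: real) = 0"
        by eventually_elim simp
      then show "(\<lambda>n. indicator (E n) x :: real) \<longlonglongrightarrow> 0"
        by (rule tendsto_eventually)
    qed
    show "AE x in lborel. norm (indicator (E n) x :: real) \<le> indicator {p..q} x" for n
      by (rule AE_I2) (auto simp: E_def indicator_def)
  qed measurable
  then show ?thesis
    by (simp add: E_def)
qed

text \<open>Pointwise convergence gives no control of \<open>g n\<close> at the moving point
  \<open>r n * u\<close>, so the point \<open>z\<close> is chosen by counting measure. The points
  near \<open>u\<close> that are bad for \<open>h n\<close>, or bad for \<open>g n\<close> after
  scaling by \<open>r n\<close>, have total measure below \<open>3 * \<eta> / 2\<close>, while the
  interval of candidates has length \<open>2 * \<eta>\<close>.\<close>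

lemma eventually_common_approximating_point:
  fixes g h :: "nat \<Rightarrow> real \<Rightarrow> real"
  assumes [measurable]: "\<And>n. g n \<in> borel_measurable borel" "\<And>n. h n \<in> borel_measurable borel"
    "k \<in> borel_measurable borel"
    and g: "\<And>z. z > 0 \<Longrightarrow> (\<lambda>n. g n z) \<longlonglongrightarrow> k z"
    and h: "\<And>z. z > 0 \<Longrightarrow> (\<lambda>n. h n z) \<longlonglongrightarrow> k z"
    and k: "isCont k u" and r: "r \<longlonglongrightarrow> 1" and "u > 0" "e > 0"
  shows "\<forall>\<^sub>F n in sequentially. \<exists>z>0. \<bar>h n z - k u\<bar> < e \<and> \<bar>g n (r n * z) - k u\<bar> < e"
proof -
  from k \<open>e > 0\<close> obtain d where d: "d > 0" "\<And>z. \<bar>z - u\<bar> < d \<Longrightarrow> \<bar>k z - k u\<bar> < e / 2"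
    unfolding continuous_at_eps_delta dist_real_def by (meson half_gt_zero)
  \<comment> \<open>Candidates \<open>z\<close> lie within \<open>\<eta>\<close> of
    \<open>u\<close>, and \<open>r n * z\<close> may move by another \<open>\<eta>\<close>. Dividing
    by 3 keeps the interval of radius \<open>2 * \<eta>\<close> inside the positive reals and inside
    the continuity radius \<open>d\<close>.\<close>
  define \<eta> where "\<eta> = min d u / 3"
  have \<eta>: "\<eta> > 0" "2 * \<eta> < d" "2 * \<eta> < u"
    using \<open>d > 0\<close> \<open>u > 0\<close> by (auto simp: \<eta>_def min_def)
  define E where "E f = {x \<in> {u - 2 * \<eta>..u + 2 * \<eta>}. \<not> \<bar>f x - k x\<bar> < e / 2}" for f :: "real \<Rightarrow> real"
  have E_meas: "E f \<in> sets borel" if [measurable]: "f \<in> borel_measurable borel" for f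
  proof -
    have "E f = {u - 2 * \<eta>..u + 2 * \<eta>} \<inter> {x \<in> space borel. \<not> \<bar>f x - k x\<bar> < e / 2}"
      by (auto simp: E_def)
    also have "\<dots> \<in> sets borel" by measurable
    finally show ?thesis .
  qed
  have Elm: "E f \<in> lmeasurable" if "f \<in> borel_measurable borel" for f
  proof (rule bounded_set_imp_lmeasurable)
    show "bounded (E f)"
      by (rule bounded_subset[OF bounded_closed_interval]) (auto simp: E_def)
    show "E f \<in> sets lebesgue" using E_meas[OF that] by simp
  qed
  have lim: "(\<lambda>n. measure lebesgue (E (f n))) \<longlonglongrightarrow> 0"
    if "\<And>n. f n \<in> borel_measurable borel" "\<And>z. z > 0 \<Longrightarrow> (\<lambda>n. f n z) \<longlonglongrightarrow> k z" for f
  proof -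
    have "(\<lambda>n. measure lborel (E (f n))) \<longlonglongrightarrow> 0"
      unfolding E_def using that \<eta> \<open>e > 0\<close>
      by (intro deviation_set_measure_tendsto_0) auto
    then show ?thesis using E_meas[OF that(1)] by simp
  qed
  have "\<forall>\<^sub>F n in sequentially. measure lebesgue (E (g n)) < \<eta> / 2"
    using order_tendstoD(2)[OF lim[of g], of "\<eta> / 2"] g \<eta> by simp
  moreover have "\<forall>\<^sub>F n in sequentially. measure lebesgue (E (h n)) < \<eta> / 2"
    using order_tendstoD(2)[OF lim[of h], of "\<eta> / 2"] h \<eta> by simp
  \<comment> \<open>The bound \<open>1/2\<close> ensures that division by \<open>r n\<close> at most
    doubles measures. The bound \<open>\<eta> / (u + \<eta>)\<close> ensures that a candidate
    \<open>z \<le> u + \<eta>\<close> is moved by at most \<open>\<eta>\<close>.\<close>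
  moreover have "\<forall>\<^sub>F n in sequentially. \<bar>r n - 1\<bar> < min (1/2) (\<eta> / (u + \<eta>))"
    using tendstoD[OF r, of "min (1/2) (\<eta> / (u + \<eta>))"] \<eta> \<open>u > 0\<close> by (simp add: dist_real_def)
  ultimately show ?thesis
  proof eventually_elim
    case (elim n)
    have r2: "r n > 1/2" using elim(3) by linarith
    have shift: "r n * z \<in> {u - 2 * \<eta>..u + 2 * \<eta>}" if z: "z \<in> {u - \<eta>..u + \<eta>}" for z
    proof -
      have "z > 0" using z \<eta> by auto
      have "\<bar>r n * z - z\<bar> = \<bar>(r n - 1) * z\<bar>"
        by (simp add: left_diff_distrib)
      also have "\<dots> = \<bar>r n - 1\<bar> * z"
        using \<open>z > 0\<close> by (simp add: abs_mult)
      also have "\<dots> \<le> (\<eta> / (u + \<eta>)) * (u + \<eta>)"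
        using elim(3) z \<open>z > 0\<close> \<eta> by (intro mult_mono) auto
      also have "\<dots> = \<eta>" using \<eta> \<open>u > 0\<close> by simp
      finally show ?thesis using z by auto
    qed
    have "\<exists>z\<in>{u - \<eta>..u + \<eta>}. z \<notin> E (h n) \<and> r n * z \<notin> E (g n)"
    proof (rule ccontr)
      assume "\<not> ?thesis"
      \<comment> \<open>The candidates that are bad for \<open>g n\<close> form the image of
        \<open>E (g n)\<close> under division by \<open>r n\<close>, written in the affine form of
        \<open>measure_lebesgue_affine\<close>.\<close>
      then have sub: "{u - \<eta>..u + \<eta>} \<subseteq> E (h n) \<union> (\<lambda>x. (1 / r n) *\<^sub>R x + 0) ` E (g n)"
      proof (intro subsetI)
        fix z assume "z \<in> {u - \<eta>..u + \<eta>}"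
        then have "z \<in> E (h n) \<or> r n * z \<in> E (g n)" using \<open>\<not> _\<close> by blast
        moreover have "z = (1 / r n) *\<^sub>R (r n * z) + 0" using r2 by simp
        ultimately show "z \<in> E (h n) \<union> (\<lambda>x. (1 / r n) *\<^sub>R x + 0) ` E (g n)"
          by (metis Un_iff image_eqI)
      qed
      have lm: "(\<lambda>x. (1 / r n) *\<^sub>R x + 0) ` E (g n) \<in> lmeasurable"
      proof (rule bounded_set_imp_lmeasurable)
        have "bounded (E (g n))"
          by (rule bounded_subset[OF bounded_closed_interval]) (auto simp: E_def)
        then show "bounded ((\<lambda>x. (1 / r n) *\<^sub>R x + 0) ` E (g n))"
          by (simp only: add_0_right bounded_scaling)
        have "(\<lambda>x. (1 / r n) *\<^sub>R x + 0) ` E (g n) = (\<lambda>x. r n * x) -` E (g n) \<inter> space borel"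
          using r2 by (auto simp: image_iff intro!: bexI[of _ "r n * _"])
        also have "\<dots> \<in> sets borel"
          using E_meas[of "g n"] by (intro measurable_sets[where A = borel]) auto
        finally show "(\<lambda>x. (1 / r n) *\<^sub>R x + 0) ` E (g n) \<in> sets lebesgue"
          by simp
      qed
      have "2 * \<eta> = measure lebesgue {u - \<eta>..u + \<eta>}"
        using \<eta> by simp
      also have "\<dots> \<le> measure lebesgue (E (h n) \<union> (\<lambda>x. (1 / r n) *\<^sub>R x + 0) ` E (g n))"
        using sub Elm[of "h n"] lm by (intro measure_mono_fmeasurable fmeasurable.Un) auto
      also have "\<dots> \<le> measure lebesgue (E (h n)) + measure lebesgue ((\<lambda>x. (1 / r n) *\<^sub>R x + 0) ` E (g n))"
        using Elm[of "h n"] lm by (intro measure_Un_le) auto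
      also have "measure lebesgue ((\<lambda>x. (1 / r n) *\<^sub>R x + 0) ` E (g n)) = \<bar>1 / r n\<bar> ^ DIM(real) * measure lebesgue (E (g n))"
        by (rule measure_lebesgue_affine)
      also have "\<bar>1 / r n\<bar> ^ DIM(real) * measure lebesgue (E (g n)) \<le> 2 * measure lebesgue (E (g n))"
        using r2 by (intro mult_right_mono) (auto simp: field_simps)
      finally show False using elim(1,2) \<eta> by linarith
    qed
    then obtain z where z: "z \<in> {u - \<eta>..u + \<eta>}" "z \<notin> E (h n)" "r n * z \<notin> E (g n)" by blast
    have "\<bar>h n z - k z\<bar> < e / 2" using z \<eta> by (auto simp: E_def)
    moreover have "\<bar>g n (r n * z) - k (r n * z)\<bar> < e / 2" using z shift by (auto simp: E_def)
    moreover have "\<bar>k z - k u\<bar> < e / 2" using z \<eta> by (intro d) auto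
    moreover have "\<bar>k (r n * z) - k u\<bar> < e / 2" using shift[OF z(1)] \<eta> by (intro d) auto
    ultimately have "\<bar>h n z - k u\<bar> < e \<and> \<bar>g n (r n * z) - k u\<bar> < e" by linarith
    moreover have "z > 0" using z \<eta> by auto
    ultimately show ?case by blast
  qed
qed

text \<open>The point found for a tolerance \<open>e\<close> depends on \<open>e\<close>. Taking a
  near-minimiser of the total deviation \<open>D n\<close> gives one sequence that serves all
  tolerances at once.\<close>

lemma common_approximating_sequence:
  fixes g h :: "nat \<Rightarrow> real \<Rightarrow> real"
  assumes "\<And>n. g n \<in> borel_measurable borel" "\<And>n. h n \<in> borel_measurable borel"
    "k \<in> borel_measurable borel"
    and "\<And>z. z > 0 \<Longrightarrow> (\<lambda>n. g n z) \<longlonglongrightarrow> k z"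
    and "\<And>z. z > 0 \<Longrightarrow> (\<lambda>n. h n z) \<longlonglongrightarrow> k z"
    and "isCont k u" "r \<longlonglongrightarrow> 1" "u > 0"
  obtains z where "\<And>n. z n > 0" "(\<lambda>n. h n (z n)) \<longlonglongrightarrow> k u" "(\<lambda>n. g n (r n * z n)) \<longlonglongrightarrow> k u"
proof -
  define D where "D n z = \<bar>h n z - k u\<bar> + \<bar>g n (r n * z) - k u\<bar>" for n z
  have bdd: "bdd_below (D n ` {0<..})" for n
    by (rule bdd_belowI[of _ 0]) (auto simp: D_def)
  \<comment> \<open>The infimum need not be attained, hence the vanishing slack
    \<open>1 / real (Suc n)\<close>.\<close>
  have "\<exists>z>0. D n z < Inf (D n ` {0<..}) + 1 / real (Suc n)" for n
    using cInf_lessD[of "D n ` {0<..}" "Inf (D n ` {0<..}) + 1 / real (Suc n)"] by auto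
  then obtain z where z: "\<And>n. z n > 0"
    "\<And>n. D n (z n) < Inf (D n ` {0<..}) + 1 / real (Suc n)" by metis
  have D0: "(\<lambda>n. D n (z n)) \<longlonglongrightarrow> 0"
  proof (rule tendstoI)
    fix e :: real assume "e > 0"
    have "\<forall>\<^sub>F n in sequentially. \<exists>z>0. \<bar>h n z - k u\<bar> < e / 4 \<and> \<bar>g n (r n * z) - k u\<bar> < e / 4"
      using assms \<open>e > 0\<close> by (intro eventually_common_approximating_point) auto
    moreover have "\<forall>\<^sub>F n in sequentially. 1 / real (Suc n) < e / 2"
      using order_tendstoD(2)[OF LIMSEQ_inverse_real_of_nat, of "e / 2"] \<open>e > 0\<close>
      by (simp add: inverse_eq_divide)
    ultimately show "\<forall>\<^sub>F n in sequentially. dist (D n (z n)) 0 < e"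
    proof eventually_elim
      case (elim n)
      then obtain y where "y > 0" "D n y < e / 2" by (force simp: D_def)
      then have "Inf (D n ` {0<..}) < e / 2"
        using cInf_lower[OF _ bdd, of "D n y" n] by force
      then have "D n (z n) < e" using z(2)[of n] elim(2) by linarith
      then show ?case by (simp add: D_def)
    qed
  qed
  have "(\<lambda>n. h n (z n) - k u) \<longlonglongrightarrow> 0"
    by (rule Lim_null_comparison[OF _ D0]) (simp add: D_def)
  moreover have "(\<lambda>n. g n (r n * z n) - k u) \<longlonglongrightarrow> 0"
    by (rule Lim_null_comparison[OF _ D0]) (simp add: D_def)
  ultimately show ?thesis
    using that[OF z(1)] by (simp add: LIM_zero_iff)
qed

text \<open>Evaluated along common approximating sequences for \<open>u\<close> and
  \<open>v\<close>, both differences in \<open>eq\<close> tend to the same nonzero number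
  \<open>k u - k v\<close>, and \<open>p n\<close> is their quotient.\<close>

lemma scaling_factor_tendsto_1:
  fixes g h :: "nat \<Rightarrow> real \<Rightarrow> real"
  assumes gh: "\<And>n. g n \<in> borel_measurable borel" "\<And>n. h n \<in> borel_measurable borel"
    "k \<in> borel_measurable borel"
    "\<And>z. z > 0 \<Longrightarrow> (\<lambda>n. g n z) \<longlonglongrightarrow> k z"
    "\<And>z. z > 0 \<Longrightarrow> (\<lambda>n. h n z) \<longlonglongrightarrow> k z"
    and k: "\<And>z. z > 0 \<Longrightarrow> isCont k z" and r: "r \<longlonglongrightarrow> 1"
    and uv: "u > 0" "v > 0" "k u \<noteq> k v"
    and eq: "\<forall>\<^sub>F n in sequentially. \<forall>y>0. \<forall>z>0.
      p n * (h n y - h n z) = g n (r n * y) - g n (r n * z)"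
  shows "p \<longlonglongrightarrow> (1 :: real)"
proof -
  obtain y where y: "\<And>n. y n > 0" "(\<lambda>n. h n (y n)) \<longlonglongrightarrow> k u" "(\<lambda>n. g n (r n * y n)) \<longlonglongrightarrow> k u"
    using common_approximating_sequence[OF gh k[OF uv(1)] r uv(1)] by blast
  obtain z where z: "\<And>n. z n > 0" "(\<lambda>n. h n (z n)) \<longlonglongrightarrow> k v" "(\<lambda>n. g n (r n * z n)) \<longlonglongrightarrow> k v"
    using common_approximating_sequence[OF gh k[OF uv(2)] r uv(2)] by blast
  have den: "(\<lambda>n. h n (y n) - h n (z n)) \<longlonglongrightarrow> k u - k v"
    by (intro tendsto_intros y z)
  have "(\<lambda>n. (g n (r n * y n) - g n (r n * z n)) / (h n (y n) - h n (z n))) \<longlonglongrightarrow> (k u - k v) / (k u - k v)"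
    using uv by (intro tendsto_divide den tendsto_diff y z) auto
  moreover have "\<forall>\<^sub>F n in sequentially. h n (y n) - h n (z n) \<noteq> 0"
    using tendsto_imp_eventually_ne[OF den, of 0] uv by simp
  then have "\<forall>\<^sub>F n in sequentially. (g n (r n * y n) - g n (r n * z n)) / (h n (y n) - h n (z n)) = p n"
    using eq by eventually_elim (metis y(1) z(1) nonzero_mult_div_cancel_right)
  ultimately show ?thesis
    using uv by (simp add: Lim_transform_eventually)
qed

section \<open>Regular variation and the scaling function\<close>

lemma RV_eventually_nonzero:
  assumes "f \<in> RV \<gamma>"
  shows "\<forall>\<^sub>F t in at_top. f t \<noteq> 0"
proof -
  have "((\<lambda>t. f (t * 1) / f t) \<longlongrightarrow> 1 powr \<gamma>) at_top"
    using assms unfolding RV_def by (blast intro: zero_less_one)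
  then have "\<forall>\<^sub>F t in at_top. f (t * 1) / f t > 0"
    by (rule order_tendstoD) simp
  then show ?thesis
    by eventually_elim auto
qed

lemma RV_eventually_pos:
  assumes "f \<in> RV \<gamma>"
  shows "\<forall>\<^sub>F t in at_top. f t > 0"
  using RV_eventually_nonzero[OF assms] eventually_ge_at_top[of 0]
proof eventually_elim
  case (elim t)
  have "f t \<ge> 0"
    using assms elim(2) by (simp add: RV_def nonneg_on_nonneg_def)
  with elim(1) show ?case by simp
qed

text \<open>Monotonicity takes the place of uniform convergence: \<open>s' n\<close> is eventually
  below \<open>s n * x\<close> for fixed \<open>x > 1\<close> and above it for fixed
  \<open>x < 1\<close>, and \<open>x powr \<gamma>\<close> is close to 1 for \<open>x\<close> near
  1.\<close>

lemma RV_mono_ratio_tendsto_1: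
  assumes f: "f \<in> RV \<gamma>" and mono: "mono_on {0..} f"
    and s: "filterlim s at_top G" and s': "filterlim s' at_top G"
    and ratio: "((\<lambda>n. s' n / s n) \<longlongrightarrow> 1) G"
  shows "((\<lambda>n. f (s' n) / f (s n)) \<longlongrightarrow> 1) G"
proof -
  have lim: "((\<lambda>n. f (s n * x) / f (s n)) \<longlongrightarrow> x powr \<gamma>) G" if "x > 0" for x
    using f that by (auto simp: RV_def intro: filterlim_compose[OF _ s])
  have pos: "\<forall>\<^sub>F n in G. s n > 0 \<and> s' n > 0 \<and> f (s n) > 0"
    using filterlim_at_top_dense[THEN iffD1, OF s, rule_format, of 0]
      filterlim_at_top_dense[THEN iffD1, OF s', rule_format, of 0]
      eventually_compose_filterlim[OF RV_eventually_pos[OF f] s]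
    by eventually_elim simp
  have cont: "((\<lambda>x. x powr \<gamma>) \<longlongrightarrow> (1 :: real)) (at 1)"
    by (rule tendsto_eq_intros | simp)+
  show ?thesis
  proof (rule order_tendstoI)
    fix l :: real assume "l < 1"
    have "\<forall>\<^sub>F x in at_left 1. x powr \<gamma> > l"
      using order_tendstoD(1)[OF cont \<open>l < 1\<close>] by (simp add: eventually_at_split)
    moreover have "\<forall>\<^sub>F x in at_left 1. x \<in> {0<..<1::real}"
      by (rule eventually_at_leftI[of 0]) auto
    ultimately have "\<forall>\<^sub>F x in at_left (1::real). x powr \<gamma> > l \<and> x \<in> {0<..<1}"
      by (rule eventually_conj)
    then obtain x where x: "x powr \<gamma> > l" "0 < x" "x < 1"
      using eventually_happens[of _ "at_left (1::real)"] by (auto simp: trivial_limit_at_left_real)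
    show "\<forall>\<^sub>F n in G. f (s' n) / f (s n) > l"
      using order_tendstoD(1)[OF lim[OF x(2)] x(1)] order_tendstoD(1)[OF ratio x(3)] pos
    proof eventually_elim
      case (elim n)
      then have "s n * x \<le> s' n" by (simp add: field_simps)
      then have "f (s n * x) \<le> f (s' n)"
        using elim x by (intro mono_onD[OF mono]) auto
      then have "f (s n * x) / f (s n) \<le> f (s' n) / f (s n)"
        using elim by (intro divide_right_mono) auto
      with elim(1) show ?case by linarith
    qed
  next
    fix l :: real assume "1 < l"
    have "\<forall>\<^sub>F x in at_right 1. x powr \<gamma> < l"
      using order_tendstoD(2)[OF cont \<open>1 < l\<close>] by (simp add: eventually_at_split)
    moreover have "\<forall>\<^sub>F x in at_right 1. x \<in> {1<..<2::real}"
      by (rule eventually_at_rightI[of _ 2]) auto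
    ultimately have "\<forall>\<^sub>F x in at_right (1::real). x powr \<gamma> < l \<and> x \<in> {1<..<2}"
      by (rule eventually_conj)
    then obtain x where x: "x powr \<gamma> < l" "1 < x"
      using eventually_happens[of _ "at_right (1::real)"] by (auto simp: trivial_limit_at_right_real)
    then have "x > 0" by simp
    show "\<forall>\<^sub>F n in G. f (s' n) / f (s n) < l"
      using order_tendstoD(2)[OF lim[OF \<open>x > 0\<close>] x(1)] order_tendstoD(2)[OF ratio x(2)] pos
    proof eventually_elim
      case (elim n)
      then have "s' n \<le> s n * x" by (simp add: field_simps)
      then have "f (s' n) \<le> f (s n * x)"
        using elim x by (intro mono_onD[OF mono]) auto
      then have "f (s' n) / f (s n) \<le> f (s n * x) / f (s n)"
        using elim by (intro divide_right_mono) auto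
      with elim(1) show ?case by linarith
    qed
  qed
qed

text \<open>Up to the factor \<open>t * x\<close>, the values of \<open>F\<close> at
  \<open>b (t * x)\<close> and \<open>b t * y\<close> tend to 1 and to
  \<open>x * y powr (-\<alpha>)\<close>. These limits coincide exactly at
  \<open>y = x powr (1 / \<alpha>)\<close>. For any other \<open>y > 0\<close> they compare
  strictly, and antitonicity of \<open>F\<close> turns this into a comparison of the
  arguments.\<close>

lemma scaling_function_RV:
  assumes anti: "antimono F" and F: "F \<in> RV_tail \<alpha> b"
  shows "b \<in> RV (1 / \<alpha>)"
proof -
  have "\<alpha> > 0" and nn: "nonneg_on_nonneg b" and b: "filterlim b at_top at_top"
    and lim: "\<And>x. x > 0 \<Longrightarrow> ((\<lambda>t. t * F (b t * x)) \<longlongrightarrow> x powr (-\<alpha>)) at_top"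
    using F by (auto simp: RV_tail_def)
  have bpos: "\<forall>\<^sub>F t in at_top. b t > 0"
    using b by (simp add: filterlim_at_top_dense)
  have "((\<lambda>t. b (t * x) / b t) \<longlongrightarrow> x powr (1 / \<alpha>)) at_top" if x: "x > 0" for x
  proof -
    have scale: "filterlim (\<lambda>t. t * x) at_top at_top"
      using x by (intro filterlim_at_top_mult_tendsto_pos[OF tendsto_const _ filterlim_ident] | simp)+
    have lim1: "((\<lambda>t. (t * x) * F (b (t * x))) \<longlongrightarrow> 1) at_top"
      using filterlim_compose[OF lim[OF zero_less_one] scale] by simp
    have limy: "((\<lambda>t. x * (t * F (b t * y))) \<longlongrightarrow> x * y powr (-\<alpha>)) at_top" if "y > 0" for y
      by (intro tendsto_intros lim that)
    have cmp: "x * y powr (-\<alpha>) > 1" if "0 < y" "y < x powr (1 / \<alpha>)" for y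
    proof -
      have "y powr \<alpha> < (x powr (1 / \<alpha>)) powr \<alpha>"
        using that \<open>\<alpha> > 0\<close> by (intro powr_less_mono2) auto
      then have "y powr \<alpha> < x" using \<open>\<alpha> > 0\<close> x by (simp add: powr_powr)
      then show ?thesis using that by (simp add: powr_minus field_simps)
    qed
    have cmp': "x * y powr (-\<alpha>) < 1" if "y > x powr (1 / \<alpha>)" for y
    proof -
      have "y powr \<alpha> > (x powr (1 / \<alpha>)) powr \<alpha>"
        using that \<open>\<alpha> > 0\<close> by (intro powr_less_mono2) auto
      then have "y powr \<alpha> > x" using \<open>\<alpha> > 0\<close> x by (simp add: powr_powr)
      moreover have "y > 0" using that powr_ge_zero[of x "1 / \<alpha>"] by linarith
      ultimately show ?thesis by (simp add: powr_minus field_simps)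
    qed
    show ?thesis
    proof (rule order_tendstoI)
      fix l assume l: "l < x powr (1 / \<alpha>)"
      \<comment> \<open>The bound \<open>l\<close> may be negative or zero; the maximum replaces it
        by a positive \<open>y\<close> still below the limit.\<close>
      define y where "y = max l (x powr (1 / \<alpha>) / 2)"
      have y: "0 < y" "y < x powr (1 / \<alpha>)" "l \<le> y"
        using l x by (auto simp: y_def less_max_iff_disj)
      obtain m where m: "1 < m" "m < x * y powr (-\<alpha>)" using dense[OF cmp[OF y(1,2)]] by blast
      show "\<forall>\<^sub>F t in at_top. b (t * x) / b t > l"
        using order_tendstoD(1)[OF limy[OF y(1)] m(2)] order_tendstoD(2)[OF lim1 m(1)] bpos
          eventually_gt_at_top[of 0]
      proof eventually_elim
        case (elim t)
        have "(t * x) * F (b (t * x)) < x * (t * F (b t * y))"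
          using elim by linarith
        also have "\<dots> = (t * x) * F (b t * y)" by simp
        finally have "F (b (t * x)) < F (b t * y)" using elim x by simp
        then have "b t * y < b (t * x)"
          using antimonoD[OF anti, of "b (t * x)" "b t * y"] by (meson not_le)
        then have "y < b (t * x) / b t" using elim by (simp add: field_simps)
        with y(3) show ?case by linarith
      qed
    next
      fix l assume l: "x powr (1 / \<alpha>) < l"
      then have "l > 0" using powr_ge_zero[of x "1 / \<alpha>"] by linarith
      obtain m where m: "x * l powr (-\<alpha>) < m" "m < 1" using dense[OF cmp'[OF l]] by blast
      show "\<forall>\<^sub>F t in at_top. b (t * x) / b t < l"
        using order_tendstoD(2)[OF limy[OF \<open>l > 0\<close>] m(1)] order_tendstoD(1)[OF lim1 m(2)] bpos
          eventually_gt_at_top[of 0]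
      proof eventually_elim
        case (elim t)
        have "(t * x) * F (b t * l) = x * (t * F (b t * l))" by simp
        also have "\<dots> < (t * x) * F (b (t * x))"
          using elim by linarith
        finally have "F (b t * l) < F (b (t * x))" using elim x by simp
        then have "b (t * x) < b t * l"
          using antimonoD[OF anti, of "b t * l" "b (t * x)"] by (meson not_le)
        then show ?case using elim by (simp add: field_simps)
      qed
    qed
  qed
  then show ?thesis using nn by (simp add: RV_def)
qed

section \<open>Slow change of the auxiliary function\<close>

text \<open>The normalised quotients at \<open>s n\<close> and \<open>s' n\<close> fit
  \<open>scaling_factor_tendsto_1\<close> with the factor \<open>q n * (a (s' n) / a (s n))\<close>,
  where \<open>q\<close> tends to 1 by regular variation of \<open>b\<close>.\<close>

lemma auxiliary_function_ratio_tendsto_1: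
  fixes s s' :: "nat \<Rightarrow> real"
  assumes anti: "antimono F" and F: "F \<in> RV_tail \<alpha> b"
    and second: "\<And>x. x > 0 \<Longrightarrow>
      ((\<lambda>t. (t * F (b t * x) - x powr (-\<alpha>)) / a t) \<longlongrightarrow> x powr (-\<alpha>) * k x) at_top"
    and a: "\<forall>\<^sub>F t in at_top. a t \<noteq> 0"
    and k: "k \<in> borel_measurable borel" "\<And>x. x > 0 \<Longrightarrow> isCont k x"
    and uv: "u > 0" "v > 0" "k u \<noteq> k v"
    and s: "filterlim s at_top sequentially" and s': "filterlim s' at_top sequentially"
    and ratio: "(\<lambda>n. s' n / s n) \<longlonglongrightarrow> 1"
  shows "(\<lambda>n. a (s' n) / a (s n)) \<longlonglongrightarrow> 1"
proof -
  have [measurable]: "F \<in> borel_measurable borel"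
  proof -
    have "(\<lambda>x. - F x) \<in> borel_measurable borel"
      using anti by (intro borel_measurable_mono) (auto simp: monotone_on_def)
    then show ?thesis by simp
  qed
  have bRV: "b \<in> RV (1 / \<alpha>)" using anti F by (rule scaling_function_RV)
  define r where "r n = b (s' n) / b (s n)" for n
  have r: "r \<longlonglongrightarrow> 1"
    unfolding r_def using F
    by (intro RV_mono_ratio_tendsto_1[OF bRV _ s s' ratio]) (auto simp: RV_tail_def)
  \<comment> \<open>Multiplying by \<open>z powr \<alpha>\<close> turns the subtracted power into
    the constant 1, which cancels in differences over \<open>z\<close>.\<close>
  define f where "f t z = z powr \<alpha> * ((t * F (b t * z) - z powr (-\<alpha>)) / a t)" for t z
  have [measurable]: "f t \<in> borel_measurable borel" for t
    unfolding f_def by measurable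
  have f_lim: "(\<lambda>n. f (\<sigma> n) z) \<longlonglongrightarrow> k z"
    if "filterlim \<sigma> at_top sequentially" "z > 0" for \<sigma> z
  proof -
    have "(\<lambda>n. f (\<sigma> n) z) \<longlonglongrightarrow> z powr \<alpha> * (z powr (-\<alpha>) * k z)"
      unfolding f_def
      by (intro tendsto_intros filterlim_compose[OF second that(1)] that)
    also have "z powr \<alpha> * (z powr (-\<alpha>) * k z) = k z"
      using that(2) by (simp add: powr_minus)
    finally show ?thesis .
  qed
  have f_eq: "f t z = (z powr \<alpha> * (t * F (b t * z)) - 1) / a t" if "z > 0" for t z
    using that by (simp add: f_def powr_minus right_diff_distrib)
  \<comment> \<open>This is the factor relating
    \<open>z powr \<alpha> * (s' n * F (b (s' n) * z))\<close> to the same expression at time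
    \<open>s n\<close> and argument \<open>r n * z\<close>; it does not depend on
    \<open>z\<close>.\<close>
  define q where "q n = r n powr \<alpha> / (s' n / s n)" for n
  have q: "q \<longlonglongrightarrow> 1 powr \<alpha> / 1"
    unfolding q_def by (intro tendsto_intros r ratio) auto
  have good: "\<forall>\<^sub>F n in sequentially. s n > 0 \<and> s' n > 0 \<and> b (s n) > 0 \<and> b (s' n) > 0 \<and> a (s n) \<noteq> 0 \<and> a (s' n) \<noteq> 0"
    using filterlim_at_top_dense[THEN iffD1, OF s, rule_format, of 0]
      filterlim_at_top_dense[THEN iffD1, OF s', rule_format, of 0]
      eventually_compose_filterlim[OF RV_eventually_pos[OF bRV] s]
      eventually_compose_filterlim[OF RV_eventually_pos[OF bRV] s']
      eventually_compose_filterlim[OF a s] eventually_compose_filterlim[OF a s']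
    by eventually_elim simp
  have p: "(\<lambda>n. q n * (a (s' n) / a (s n))) \<longlonglongrightarrow> 1"
  proof (rule scaling_factor_tendsto_1[where g = "\<lambda>n. f (s n)" and h = "\<lambda>n. f (s' n)" and k = k and u = u and v = v and r = r])
    show "\<forall>\<^sub>F n in sequentially. \<forall>y>0. \<forall>z>0.
        q n * (a (s' n) / a (s n)) * (f (s' n) y - f (s' n) z) = f (s n) (r n * y) - f (s n) (r n * z)"
      using good
    proof eventually_elim
      case (elim n)
      have rpos: "r n > 0" using elim by (simp add: r_def)
      have key: "(r n * z) powr \<alpha> * (s n * F (b (s n) * (r n * z)))
          = q n * (z powr \<alpha> * (s' n * F (b (s' n) * z)))" if "z > 0" for z
      proof -
        have *: "b (s n) * (r n * z) = b (s' n) * z" using elim by (simp add: r_def)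
        show ?thesis unfolding * using elim that rpos by (simp add: q_def powr_mult)
      qed
      show ?case
      proof (intro allI impI)
        fix y z :: real assume yz: "y > 0" "z > 0"
        have "f (s n) (r n * y) - f (s n) (r n * z)
            = q n * (y powr \<alpha> * (s' n * F (b (s' n) * y)) - z powr \<alpha> * (s' n * F (b (s' n) * z))) / a (s n)"
          using yz rpos by (simp add: f_eq key right_diff_distrib flip: diff_divide_distrib)
        also have "\<dots> = q n * (a (s' n) / a (s n)) * (f (s' n) y - f (s' n) z)"
          using yz elim by (simp add: f_eq flip: diff_divide_distrib)
        finally show "q n * (a (s' n) / a (s n)) * (f (s' n) y - f (s' n) z) = f (s n) (r n * y) - f (s n) (r n * z)" ..
      qed
    qed
  qed (use k r uv f_lim s s' in auto)
  have "(\<lambda>n. q n * (a (s' n) / a (s n)) / q n) \<longlonglongrightarrow> 1 / (1 powr \<alpha> / 1)"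
    by (intro tendsto_divide p q) simp
  moreover have "\<forall>\<^sub>F n in sequentially. q n \<noteq> 0"
    using tendsto_imp_eventually_ne[OF q, of 0] by simp
  then have "\<forall>\<^sub>F n in sequentially. q n * (a (s' n) / a (s n)) / q n = a (s' n) / a (s n)"
    by eventually_elim simp
  ultimately show ?thesis
    by (simp add: Lim_transform_eventually)
qed

section \<open>Inversion to second order\<close>

text \<open>As \<open>V\<close> may jump, \<open>V (T t)\<close> need not equal \<open>t\<close>.
  Instead \<open>t\<close> is enclosed between values of \<open>V\<close> slightly to the left and
  right of \<open>T t\<close>, and \<open>slow\<close> gives these values the same expansion
  relative to \<open>a (T t)\<close>.\<close>

lemma asymptotic_inverse:
  fixes V a :: "real \<Rightarrow> real"
  assumes mono: "mono_on {0..} V"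
    and V: "((\<lambda>s. (V s / s - 1) / a s) \<longlongrightarrow> l) at_top"
    and a0: "(a \<longlongrightarrow> 0) at_top" and a: "\<forall>\<^sub>F s in at_top. a s \<noteq> 0"
    and slow: "\<And>s s'. filterlim s at_top sequentially \<Longrightarrow> filterlim s' at_top sequentially \<Longrightarrow>
      (\<lambda>n. s' n / s n) \<longlonglongrightarrow> 1 \<Longrightarrow> (\<lambda>n. a (s' n) / a (s n)) \<longlonglongrightarrow> 1"
  obtains T where "mono T" "\<And>t. T t \<ge> 0" "filterlim T at_top at_top"
    "((\<lambda>t. (t / T t - 1) / a (T t)) \<longlongrightarrow> l) at_top"
proof -
  define w where "w s = (V s / s - 1) / a s" for s
  have w: "(w \<longlongrightarrow> l) at_top" using V by (simp add: w_def[abs_def])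
  have Vw: "\<forall>\<^sub>F s in at_top. V s / s = 1 + a s * w s"
    using a by eventually_elim (simp add: w_def)
  have "((\<lambda>s. 1 + a s * w s) \<longlongrightarrow> 1 + 0 * l) at_top"
    by (intro tendsto_intros a0 w)
  then have V1: "((\<lambda>s. V s / s) \<longlongrightarrow> 1) at_top"
    using tendsto_cong[OF Vw] by simp
  have "filterlim (\<lambda>s. V s / s * s) at_top at_top"
    by (rule filterlim_tendsto_pos_mult_at_top[OF V1 _ filterlim_ident]) simp
  moreover have "\<forall>\<^sub>F s in at_top. V s / s * s = V s"
    using eventually_gt_at_top[of 0] by eventually_elim simp
  ultimately have V_top: "filterlim V at_top at_top"
    by (simp cong: filterlim_cong)
  \<comment> \<open>The inserted 0 keeps the set nonempty for every \<open>t\<close>, so that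
    \<open>T\<close> is nonnegative and monotone on the whole line.\<close>
  define S where "S t = insert 0 {s. s \<ge> 0 \<and> V s \<le> t}" for t
  define T where "T t = Sup (S t)" for t
  have bdd: "bdd_above (S t)" for t
  proof -
    have "\<forall>\<^sub>F s in at_top. V s > t \<and> s \<ge> 0"
      using V_top eventually_ge_at_top[of 0]
      by (simp add: filterlim_at_top_dense eventually_conj)
    then obtain B where B: "\<And>s. s \<ge> B \<Longrightarrow> V s > t \<and> s \<ge> 0"
      by (auto simp: eventually_at_top_linorder)
    show ?thesis
    proof (rule bdd_aboveI)
      fix s assume "s \<in> S t"
      then show "s \<le> B" using B[of s] B[of B] by (auto simp: S_def intro: le_cases[of s B])
    qed
  qed
  have T_ge: "s \<le> T t" if "s \<ge> 0" "V s \<le> t" for s t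
    unfolding T_def using that by (intro cSup_upper bdd) (simp add: S_def)
  have T_nonneg: "T t \<ge> 0" for t
    unfolding T_def by (intro cSup_upper bdd) (simp add: S_def)
  have T_mono: "mono T"
    unfolding T_def by (intro monoI cSup_subset_mono bdd) (auto simp: S_def)
  have T_top: "filterlim T at_top at_top"
    unfolding filterlim_at_top
  proof
    fix Z :: real
    show "\<forall>\<^sub>F t in at_top. Z \<le> T t"
      using eventually_ge_at_top[of "V (max Z 0)"]
      by eventually_elim (use T_ge[of "max Z 0"] in fastforce)
  qed
  \<comment> \<open>The nearby points \<open>s (1 \<plusminus> a(s)\<^sup>2)\<close> are close enough to \<open>s\<close> to give the same first-order
    behaviour relative to \<open>a\<close>, and \<open>V\<close> at these points encloses \<open>t\<close> when \<open>s = T t\<close>.\<close>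
  define near where "near \<sigma> s = s * (1 + \<sigma> * (a s)\<^sup>2)" for \<sigma> s
  define D where "D \<sigma> s = (V (near \<sigma> s) / s - 1) / a s" for \<sigma> s
  have D: "(D \<sigma> \<longlongrightarrow> l) at_top" for \<sigma>
  proof -
    have factor: "((\<lambda>s. 1 + \<sigma> * (a s)\<^sup>2) \<longlongrightarrow> 1) at_top"
      by (rule tendsto_eq_intros a0 | simp)+
    have near_top: "filterlim (near \<sigma>) at_top at_top"
      using filterlim_tendsto_pos_mult_at_top[OF factor _ filterlim_ident]
      by (simp add: near_def[abs_def] mult.commute)
    have near_ratio: "((\<lambda>s. near \<sigma> s / s) \<longlongrightarrow> 1) at_top"
    proof (rule Lim_transform_eventually[OF factor])
      show "\<forall>\<^sub>F s in at_top. 1 + \<sigma> * (a s)\<^sup>2 = near \<sigma> s / s"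
        using eventually_gt_at_top[of 0] by eventually_elim (simp add: near_def)
    qed
    have a_ratio: "((\<lambda>s. a (near \<sigma> s) / a s) \<longlongrightarrow> 1) at_top"
    proof (rule tendsto_at_topI_sequentially)
      fix s :: "nat \<Rightarrow> real" assume s: "filterlim s at_top sequentially"
      show "(\<lambda>n. a (near \<sigma> (s n)) / a (s n)) \<longlonglongrightarrow> 1"
        using filterlim_compose[OF near_top s] filterlim_compose[OF near_ratio s]
        by (intro slow[OF s])
    qed
    \<comment> \<open>This is \<open>D \<sigma> s\<close> after expanding
      \<open>V (near \<sigma> s) / s\<close> as \<open>(1 + \<sigma> * (a s)\<^sup>2) * (1 + a (near
      \<sigma> s) * w (near \<sigma> s))\<close>.\<close>
    have "((\<lambda>s. \<sigma> * a s + (1 + \<sigma> * (a s)\<^sup>2) * (a (near \<sigma> s) / a s) * w (near \<sigma> s)) \<longlongrightarrow> \<sigma> * 0 + 1 * 1 * l) at_top"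
      by (intro tendsto_intros a0 factor a_ratio filterlim_compose[OF w near_top])
    moreover have "\<forall>\<^sub>F s in at_top. \<sigma> * a s + (1 + \<sigma> * (a s)\<^sup>2) * (a (near \<sigma> s) / a s) * w (near \<sigma> s) = D \<sigma> s"
      using a eventually_compose_filterlim[OF Vw near_top] eventually_gt_at_top[of 0]
        eventually_compose_filterlim[OF eventually_gt_at_top[of 0] near_top]
    proof eventually_elim
      case (elim s)
      have "V (near \<sigma> s) / s = (near \<sigma> s / s) * (V (near \<sigma> s) / near \<sigma> s)"
        using elim(3,4) by simp
      also have "\<dots> = (1 + \<sigma> * (a s)\<^sup>2) * (1 + a (near \<sigma> s) * w (near \<sigma> s))"
        unfolding elim(2) using elim by (simp add: near_def)
      finally have V_near: "V (near \<sigma> s) / s = (1 + \<sigma> * (a s)\<^sup>2) * (1 + a (near \<sigma> s) * w (near \<sigma> s))" .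
      show ?case
        unfolding D_def V_near using elim(1) by (simp add: field_simps power2_eq_square)
    qed
    ultimately show ?thesis
      by (simp add: Lim_transform_eventually)
  qed
  have "((\<lambda>t. (t / T t - 1) / a (T t) - l) \<longlongrightarrow> 0) at_top"
  proof (rule Lim_null_comparison)
    have "((\<lambda>t. \<bar>D 1 (T t) - l\<bar> + \<bar>D (-1) (T t) - l\<bar>) \<longlongrightarrow> \<bar>l - l\<bar> + \<bar>l - l\<bar>) at_top"
      by (intro tendsto_intros filterlim_compose[OF D T_top])
    then show "((\<lambda>t. \<bar>D 1 (T t) - l\<bar> + \<bar>D (-1) (T t) - l\<bar>) \<longlongrightarrow> 0) at_top" by simp
    have "\<forall>\<^sub>F s in at_top. \<bar>a s\<bar> < 1"
      using tendstoD[OF a0, of 1] by simp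
    from eventually_compose_filterlim[OF this T_top] eventually_compose_filterlim[OF a T_top]
        eventually_compose_filterlim[OF eventually_gt_at_top[of 0] T_top]
    show "\<forall>\<^sub>F t in at_top. norm ((t / T t - 1) / a (T t) - l) \<le> \<bar>D 1 (T t) - l\<bar> + \<bar>D (-1) (T t) - l\<bar>"
    proof eventually_elim
      case (elim t)
      define x where "x = (a (T t))\<^sup>2"
      have x: "0 < x" "x < 1"
        using elim by (auto simp: x_def abs_square_less_1)
      have "T t < near 1 (T t)"
        using elim x by (simp add: near_def flip: x_def)
      then have "t < V (near 1 (T t))"
        using T_ge[of "near 1 (T t)" t] elim by linarith
      then have upper: "t / T t - 1 \<le> V (near 1 (T t)) / T t - 1"
        using elim by (simp add: divide_right_mono)
      have near': "0 \<le> near (-1) (T t)" "near (-1) (T t) < T t"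
        using elim x by (auto simp: near_def simp flip: x_def)
      have "S t \<noteq> {}" by (simp add: S_def)
      then obtain s where s: "s \<in> S t" "near (-1) (T t) < s"
        using near'(2) less_cSupE[of "near (-1) (T t)" "S t"] unfolding T_def by blast
      then have "V (near (-1) (T t)) \<le> V s"
        using near' by (intro mono_onD[OF mono]) auto
      \<comment> \<open>Since \<open>s\<close> exceeds the nonnegative
        \<open>near (-1) (T t)\<close>, it is not the inserted 0.\<close>
      also have "V s \<le> t" using s near' by (auto simp: S_def)
      finally have lower: "V (near (-1) (T t)) / T t - 1 \<le> t / T t - 1"
        using elim by (simp add: divide_right_mono)
      \<comment> \<open>Division by \<open>a (T t)\<close> may reverse the enclosure. In either
        order the distance to \<open>l\<close> is at most the sum of the distances of the two
        bounds.\<close>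
      have "(D (-1) (T t) \<le> (t / T t - 1) / a (T t) \<and> (t / T t - 1) / a (T t) \<le> D 1 (T t)) \<or>
            (D 1 (T t) \<le> (t / T t - 1) / a (T t) \<and> (t / T t - 1) / a (T t) \<le> D (-1) (T t))"
      proof (cases "a (T t) > 0")
        case True
        then show ?thesis using upper lower by (auto simp: D_def intro!: divide_right_mono)
      next
        case False
        then show ?thesis using upper lower by (auto simp: D_def intro!: divide_right_mono_neg)
      qed
      then show ?case unfolding real_norm_def by linarith
    qed
  qed
  then show ?thesis
    using that[OF T_mono T_nonneg T_top] by (simp add: LIM_zero_iff)
qed

section \<open>Application to the tail of the random variable\<close>

lemma antimono_tail:
  assumes "prob_space M" "X \<in> borel_measurable M"
  shows "antimono (tail M X)"
proof -
  interpret prob_space "distr M borel X"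
    using assms by (intro prob_space.prob_space_distr) auto
  interpret finite_borel_measure "distr M borel X"
    by standard simp
  show ?thesis
    by (intro antimonoI) (simp add: tail_def cdf_nondecreasing)
qed

theorem proposition2p7:
  fixes M :: "'a measure" and X :: "'a \<Rightarrow> real"
    and \<alpha> \<rho> c c' :: real and b A :: "real \<Rightarrow> real"
  assumes "prob_space M"
    and "X \<in> borel_measurable M"
    and "\<alpha> > 0"
    and "tail M X \<in> RV_tail \<alpha> b"
    and "(A \<longlongrightarrow> 0) at_top"
    and "ultimately_constant_sign A"
    and "\<rho> \<le> 0"
    and "(\<lambda>t. \<bar>A t\<bar>) \<in> RV \<rho>"
    and "c \<noteq> 0"
    and "c \<noteq> c' * \<rho>"
    and "\<And>x. x > 0 \<Longrightarrow>
           ((\<lambda>t. (t * tail M X (b t * x) - x powr (-\<alpha>)) / A (b t)) \<longlongrightarrow>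
              H_2RV \<alpha> \<rho> c x + c' * x powr (-\<alpha>)) at_top"
  shows "\<exists>b' A'. b' \<in> RV (1 / \<alpha>) \<and>
           (A' \<longlongrightarrow> 0) at_top \<and> ultimately_constant_sign A' \<and> (\<lambda>t. \<bar>A' t\<bar>) \<in> RV \<rho> \<and>
           second_order_RV M X \<alpha> \<rho> b' A' (H_2RV \<alpha> \<rho> c)"
proof -
  define F where "F = tail M X"
  note \<alpha> = \<open>\<alpha> > 0\<close>
  have anti: "antimono F" unfolding F_def using assms(1,2) by (rule antimono_tail)
  have F: "F \<in> RV_tail \<alpha> b" using assms(4) by (simp add: F_def)
  then have b_mono: "mono_on {0..} b" and b_nn: "nonneg_on_nonneg b"
    and b_top: "filterlim b at_top at_top"
    and lim: "\<And>x. x > 0 \<Longrightarrow> ((\<lambda>t. t * F (b t * x)) \<longlongrightarrow> x powr (-\<alpha>)) at_top"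
    by (auto simp: RV_tail_def)
  define a where "a t = A (b t)" for t
  have a0: "(a \<longlongrightarrow> 0) at_top"
    unfolding a_def by (rule filterlim_compose[OF assms(5) b_top])
  have "\<forall>\<^sub>F t in at_top. A t \<noteq> 0"
    using RV_eventually_nonzero[OF assms(8)] by simp
  from eventually_compose_filterlim[OF this b_top]
  have a_nz: "\<forall>\<^sub>F t in at_top. a t \<noteq> 0" by (simp add: a_def)
  \<comment> \<open>Factoring out \<open>x powr (-\<alpha>)\<close> leaves a continuous nonconstant
    \<open>k\<close> with \<open>k 1 = c'\<close>.\<close>
  define k where "k x = c * (if \<rho> = 0 then ln x else (x powr \<rho> - 1) / \<rho>) + c'" for x
  have k_H: "H_2RV \<alpha> \<rho> c x + c' * x powr (-\<alpha>) = x powr (-\<alpha>) * k x" for x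
    by (simp add: H_2RV_def k_def algebra_simps)
  have second: "((\<lambda>t. (t * F (b t * x) - x powr (-\<alpha>)) / a t) \<longlongrightarrow> x powr (-\<alpha>) * k x) at_top"
    if "x > 0" for x
    using assms(11)[OF that] by (simp add: F_def a_def k_H)
  have k_meas: "k \<in> borel_measurable borel"
    unfolding k_def[abs_def] by (cases "\<rho> = 0") simp_all
  have k_cont: "isCont k x" if "x > 0" for x
    unfolding k_def[abs_def] using that by (cases "\<rho> = 0") (auto intro!: continuous_intros)
  have k_ne: "k 1 \<noteq> k 2"
  proof (cases "\<rho> = 0")
    case False
    then have "2 powr \<rho> \<noteq> (1 :: real)"
      by (simp add: powr_def)
    then show ?thesis using False assms(9) by (simp add: k_def)
  qed (use assms(9) in \<open>simp add: k_def\<close>)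
  \<comment> \<open>A zero of \<open>F\<close> would give \<open>V\<close> the default value
    \<open>1 / 0 = 0\<close> and break its monotonicity. The first-order limit makes
    \<open>F\<close> positive at arbitrarily large points, and antitonicity extends this to all
    \<open>x\<close>.\<close>
  have F_pos: "F x > 0" for x
  proof -
    have "\<forall>\<^sub>F t in at_top. t * F (b t * 1) > 0"
      by (rule order_tendstoD(1)[OF lim]) auto
    moreover have "\<forall>\<^sub>F t in at_top. b t \<ge> x"
      using b_top by (simp add: filterlim_at_top)
    ultimately have "\<forall>\<^sub>F t in at_top. t * F (b t * 1) > 0 \<and> b t \<ge> x \<and> t > 0"
      using eventually_gt_at_top[of 0] by eventually_elim simp
    then obtain t where "t * F (b t * 1) > 0" "b t \<ge> x" "t > 0"
      using eventually_happens'[OF trivial_limit_at_top_linorder] by blast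
    then show ?thesis
      using antimonoD[OF anti \<open>b t \<ge> x\<close>] by (simp add: zero_less_mult_iff)
  qed
  define V where "V s = 1 / F (b s)" for s
  have V_mono: "mono_on {0..} V"
    unfolding V_def using F_pos
    by (intro mono_onI frac_le antimonoD[OF anti] mono_onD[OF b_mono]) auto
  have V_lim: "((\<lambda>s. (V s / s - 1) / a s) \<longlongrightarrow> - c') at_top"
  proof -
    \<comment> \<open>With \<open>y = s * F (b s)\<close>, this uses
      \<open>1 / y - 1 = - (y - 1) / y\<close> and the second-order limit at 1.\<close>
    have "((\<lambda>s. - ((s * F (b s * 1) - 1 powr (-\<alpha>)) / a s) / (s * F (b s * 1)))
        \<longlongrightarrow> - (1 powr (-\<alpha>) * k 1) / 1 powr (-\<alpha>)) at_top"
      by (intro tendsto_intros second lim) auto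
    moreover have "- (1 powr (-\<alpha>) * k 1) / 1 powr (-\<alpha>) = - c'"
      by (simp add: k_def)
    moreover have "\<forall>\<^sub>F s in at_top. - ((s * F (b s * 1) - 1 powr (-\<alpha>)) / a s) / (s * F (b s * 1)) = (V s / s - 1) / a s"
      using a_nz eventually_gt_at_top[of 0]
    proof eventually_elim
      case (elim s)
      then show ?case using F_pos[of "b s"] by (simp add: V_def field_simps)
    qed
    ultimately show ?thesis by (simp add: Lim_transform_eventually)
  qed
  have slow: "(\<lambda>n. a (s' n) / a (s n)) \<longlonglongrightarrow> 1"
    if "filterlim s at_top sequentially" "filterlim s' at_top sequentially" "(\<lambda>n. s' n / s n) \<longlonglongrightarrow> 1"
    for s s' :: "nat \<Rightarrow> real"
    by (rule auxiliary_function_ratio_tendsto_1[OF anti F second a_nz k_meas k_cont _ _ k_ne that]) auto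
  obtain T where T: "mono T" "\<And>t. T t \<ge> 0" "filterlim T at_top at_top"
    and T_lim: "((\<lambda>t. (t / T t - 1) / a (T t)) \<longlongrightarrow> - c') at_top"
    using asymptotic_inverse[OF V_mono V_lim a0 a_nz slow] by blast
  \<comment> \<open>\<open>A\<close> itself can serve as the new auxiliary function, because
    \<open>A (b' t) = a (T t)\<close>.\<close>
  define b' where "b' t = b (T t)" for t
  have aT_nz: "\<forall>\<^sub>F t in at_top. a (T t) \<noteq> 0"
    by (rule eventually_compose_filterlim[OF a_nz T(3)])
  have T_ratio: "((\<lambda>t. t / T t) \<longlongrightarrow> 1) at_top"
  proof -
    have "((\<lambda>t. 1 + a (T t) * ((t / T t - 1) / a (T t))) \<longlongrightarrow> 1 + 0 * - c') at_top"
      by (intro tendsto_intros T_lim filterlim_compose[OF a0 T(3)])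
    moreover have "\<forall>\<^sub>F t in at_top. 1 + a (T t) * ((t / T t - 1) / a (T t)) = t / T t"
      using aT_nz by eventually_elim simp
    ultimately show ?thesis by (simp add: Lim_transform_eventually)
  qed
  have T_pos: "\<forall>\<^sub>F t in at_top. T t > 0"
    by (rule eventually_compose_filterlim[OF eventually_gt_at_top T(3)])
  have b'_tail: "F \<in> RV_tail \<alpha> b'"
    unfolding RV_tail_def
  proof (intro CollectI conjI allI impI)
    show "nonneg_on_nonneg b'"
      using b_nn T(2) by (simp add: nonneg_on_nonneg_def b'_def)
    show "mono_on {0..} b'"
      unfolding b'_def using T(2) by (intro mono_onI mono_onD[OF b_mono] monoD[OF T(1)]) auto
    show "filterlim b' at_top at_top"
      unfolding b'_def by (rule filterlim_compose[OF b_top T(3)])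
    fix x :: real assume x: "x > 0"
    have "((\<lambda>t. (t / T t) * (T t * F (b (T t) * x))) \<longlongrightarrow> 1 * x powr (-\<alpha>)) at_top"
      by (intro tendsto_mult T_ratio filterlim_compose[OF lim[OF x] T(3)])
    moreover have "\<forall>\<^sub>F t in at_top. (t / T t) * (T t * F (b (T t) * x)) = t * F (b' t * x)"
      using T_pos by eventually_elim (simp add: b'_def)
    ultimately show "((\<lambda>t. t * F (b' t * x)) \<longlongrightarrow> x powr (-\<alpha>)) at_top"
      by (simp add: Lim_transform_eventually)
  qed (rule \<alpha>)
  have second': "((\<lambda>t. (t * F (b' t * x) - x powr (-\<alpha>)) / A (b' t)) \<longlongrightarrow> H_2RV \<alpha> \<rho> c x) at_top"
    if x: "x > 0" for x
  proof -
    have "((\<lambda>t. (t / T t) * ((T t * F (b (T t) * x) - x powr (-\<alpha>)) / a (T t))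
          + x powr (-\<alpha>) * ((t / T t - 1) / a (T t)))
        \<longlongrightarrow> 1 * (x powr (-\<alpha>) * k x) + x powr (-\<alpha>) * - c') at_top"
      by (intro tendsto_intros T_ratio T_lim filterlim_compose[OF second[OF x] T(3)])
    moreover have "1 * (x powr (-\<alpha>) * k x) + x powr (-\<alpha>) * - c' = H_2RV \<alpha> \<rho> c x"
      using k_H[of x] by (simp add: algebra_simps)
    moreover have "\<forall>\<^sub>F t in at_top. (t / T t) * ((T t * F (b (T t) * x) - x powr (-\<alpha>)) / a (T t))
          + x powr (-\<alpha>) * ((t / T t - 1) / a (T t)) = (t * F (b' t * x) - x powr (-\<alpha>)) / A (b' t)"
      using T_pos aT_nz
    proof eventually_elim
      case (elim t)
      have "(t / T t) * (T t * F (b (T t) * x) - x powr (-\<alpha>)) + x powr (-\<alpha>) * (t / T t - 1)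
          = t * F (b (T t) * x) - x powr (-\<alpha>)"
        using elim by (simp add: field_simps)
      then show ?case
        by (simp only: b'_def a_def times_divide_eq_right flip: add_divide_distrib)
    qed
    ultimately show ?thesis by (simp add: Lim_transform_eventually)
  qed
  have "second_order_RV M X \<alpha> \<rho> b' A (H_2RV \<alpha> \<rho> c)"
    unfolding second_order_RV_def
    using assms b'_tail second' by (auto simp flip: F_def)
  then show ?thesis
    using scaling_function_RV[OF anti b'_tail] assms(5,6,8) by blast
qed

end
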